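(* Let $0\le\beta\le1$, let $m,r\in\mathbb{N}$ and let $x_1,\dots,x_{m+r}\in\mathbb{R}$ with $x_1+\cdots+x_{m+r}=x$. Then, for every $n\in\mathbb{N}_0$, $$\sum_{j_1+\cdots+j_{m+r}=n}\binom{n}{j_1,\dots,j_{m+r}}B_{j_1}(x_1)\cdots B_{j_m}(x_m)E_{j_{m+1}}(\beta;x_{m+1})\cdots E_{j_{m+r}}(\beta;x_{m+r})$$ $$=\big(B(m;\cdot)\times E(r,\beta;\cdot)\big)_n(x)=\sum_{k=0}^nv_k\,\Delta^kI_n(x),$$ where $$v_k=m!\sum_{j=0}^k\binom{-r}{j}\beta^j\,\frac{s(m+k-j,m)}{(m+k-j)!}.$$
   Context: $\mathbb{N}=\{1,2,\dots\}$, $\mathbb{N}_0=\mathbb{N}\cup\{0\}$. The first sum is over $j_1,\dots,j_{m+r}\in\mathbb{N}_0$, and $\binom{n}{j_1,\dots,j_{q}}=\frac{n!}{j_1!\cdots j_{q}!}$. For $t\in\mathbb{R}$, the generalized Bernoulli polynomials $B(t;x)=(B_n(t;x))_{n\ge0}$ are defined by $\sum_{n\ge0}B_n(t;x)\frac{z^n}{n!}=\left(\frac{z}{e^z-1}\right)^te^{xz}$ and, for $0\le\beta\le1$, the generalized Apostol-Euler polynomials $E(t,\beta;x)=(E_n(t,\beta;x))_{n\ge0}$ by $\sum_{n\ge0}E_n(t,\beta;x)\frac{z^n}{n!}=\frac{e^{xz}}{(1+\beta(e^z-1))^t}$, for complex $z$ near $0$ (branches of the powers equal to $1$ at $z=0$).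 $B_n(x)=B_n(1;x)$ and $E_n(\beta;x)=E_n(1,\beta;x)$ are the Bernoulli and Apostol-Euler polynomials. These are Appell sequences, i.e. sequences of polynomials with $A_n(x)=\sum_{k=0}^n\binom{n}{k}A_k(0)x^{n-k}$ (with $A_0(0)\ne0$ and $\sum_n|A_n(0)|\rho^n/n!<\infty$ for some $\rho>0$). The binomial convolution of Appell sequences $A(x)$, $C(x)$ is the Appell sequence $(A\times C)(x)$ with $(A\times C)_n(x)=\sum_{k=0}^n\binom{n}{k}A_k(0)C_{n-k}(x)$. $\Delta^kf(x)=\sum_{j=0}^k\binom{k}{j}(-1)^{k-j}f(x+j)$ and $I_n(x)=x^n$. $s(n,k)$ are the (signed) Stirling numbers of the first kind, $x(x-1)\cdots(x-n+1)=\sum_{k=0}^ns(n,k)x^k$. For real $y$, $\binom{y}{k}=y(y-1)\cdots(y-k+1)/k!$; $\beta^0=1$. *)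

theory Defs
  imports "HOL-Complex_Analysis.Complex_Analysis"
begin

section \<open>Exponential generating functions\<close>

text \<open>
  The expansion is only required on a punctured neighbourhood of \<open>0\<close>, since expressions such as
  \<open>z / (exp z - 1)\<close> have a removable singularity at \<open>0\<close> (where \<open>0 / 0 = 0\<close> in HOL). The
  coefficient sequence is still unique, see \<open>has_egf_unique\<close>.
\<close>

definition has_egf :: "(complex \<Rightarrow> complex) \<Rightarrow> (nat \<Rightarrow> real) \<Rightarrow> bool" where
  "has_egf f a \<longleftrightarrow>
     (\<forall>\<^sub>F z in at 0. (\<lambda>n. complex_of_real (a n) * z ^ n / fact n) sums f z)"

definition egf_coeffs :: "(complex \<Rightarrow> complex) \<Rightarrow> nat \<Rightarrow> real" where
  "egf_coeffs f = (THE a. has_egf f a)"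

lemma has_egf_imp_laurent:
  assumes "has_egf f a"
  shows   "f has_laurent_expansion fps_to_fls (Abs_fps (\<lambda>n. complex_of_real (a n) / fact n))"
proof -
  define A where "A = Abs_fps (\<lambda>n. complex_of_real (a n) / fact n)"
  define g where "g = (\<lambda>z. if z = 0 then fps_nth A 0 else f z)"
  have ev: "\<forall>\<^sub>F z in at 0. (\<lambda>n. fps_nth A n * z ^ n) sums f z"
    using assms by (simp add: has_egf_def A_def)
  have "\<forall>\<^sub>F z in at 0. (\<lambda>n. fps_nth A n * z ^ n) sums g z"
    using ev eventually_neq_at_within[of 0 0 UNIV] by eventually_elim (auto simp: g_def)
  moreover have "(\<lambda>n. fps_nth A n * 0 ^ n) sums g 0"
    using powser_sums_zero[of "fps_nth A"] by (simp add: g_def)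
  ultimately have "\<forall>\<^sub>F z in nhds 0. (\<lambda>n. fps_nth A n * z ^ n) sums g z"
    by (auto simp: eventually_nhds_conv_at)
  hence "g has_fps_expansion A"
    by (rule has_fps_expansionI)
  hence "g has_laurent_expansion fps_to_fls A"
    by (simp add: has_fps_expansion_to_laurent)
  moreover have "\<forall>\<^sub>F z in at 0. g z = f z"
    using eventually_neq_at_within[of 0 0 UNIV] by eventually_elim (auto simp: g_def)
  ultimately show ?thesis
    unfolding A_def using has_laurent_expansion_cong by blast
qed

lemma has_egf_unique:
  assumes "has_egf f a" "has_egf f b"
  shows   "a = b"
proof -
  have "fps_to_fls (Abs_fps (\<lambda>n. complex_of_real (a n) / fact n)) =
        fps_to_fls (Abs_fps (\<lambda>n. complex_of_real (b n) / fact n))"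
    using assms[THEN has_egf_imp_laurent] has_laurent_expansion_unique by blast
  thus ?thesis
    by (auto simp: fun_eq_iff fps_eq_iff)
qed

lemma egf_coeffs_eq: "has_egf f a \<Longrightarrow> egf_coeffs f = a"
  unfolding egf_coeffs_def using has_egf_unique by blast

lemma has_egf_egf_coeffs:
  assumes "F analytic_on {0}"
    and cnj: "\<forall>\<^sub>F z in at 0. F (cnj z) = cnj (F z)"
    and eq: "\<forall>\<^sub>F z in at 0. F z = f z"
  shows   "has_egf f (egf_coeffs f)"
proof -
  define A where "A = fps_expansion F 0"
  have A: "F has_fps_expansion A"
    unfolding A_def by (rule analytic_at_imp_has_fps_expansion_0) fact
  from assms(1) obtain r where r: "r > 0" "F holomorphic_on ball 0 r"
    by (auto simp: analytic_on_def)
  have sums: "(\<lambda>n. fps_nth A n * z ^ n) sums F z" if "norm z < r" for z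
    by (rule has_fps_expansion_imp_sums_complex[OF A, of "ereal r"]) (use r that in auto)
  have ball: "\<forall>\<^sub>F z in at 0. norm z < r"
    using r(1) by (auto simp: eventually_at intro!: exI[of _ r])
  define B where "B = Abs_fps (\<lambda>n. cnj (fps_nth A n))"
  have "\<forall>\<^sub>F z in nhds 0. (\<lambda>n. fps_nth B n * z ^ n) sums F z"
  proof -
    have "\<forall>\<^sub>F z in at 0. (\<lambda>n. fps_nth B n * z ^ n) sums F z"
      using ball cnj
    proof eventually_elim
      case (elim z)
      have "(\<lambda>n. cnj (fps_nth A n * cnj z ^ n)) sums cnj (F (cnj z))"
        using sums[of "cnj z"] elim(1) by (subst sums_cnj) auto
      thus ?case using elim(2) by (simp add: B_def)
    qed
    moreover have "F 0 = fps_nth A 0"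
      using A has_fps_expansion_imp_0_eq_fps_nth_0 by blast
    moreover have "cnj (F 0) = F 0"
    proof -
      have "F \<midarrow>0\<rightarrow> F 0"
        using assms(1) analytic_at_imp_isCont isContD by blast
      moreover have "(\<lambda>z. cnj (F (cnj z))) \<midarrow>0\<rightarrow> cnj (F 0)"
      proof -
        have "isCont F (cnj 0)" using assms(1) analytic_at_imp_isCont by simp
        hence "isCont (\<lambda>z. F (cnj z)) 0"
          by (rule isCont_o2[rotated]) simp
        hence "isCont (\<lambda>z. cnj (F (cnj z))) 0"
          by (rule isCont_cnj)
        thus ?thesis by (simp add: isCont_def)
      qed
      moreover have "\<forall>\<^sub>F z in at 0. cnj (F (cnj z)) = F z"
        using cnj by eventually_elim simp
      ultimately show ?thesis
        using LIM_unique[OF Lim_transform_eventually, of _ "cnj (F 0)" 0 F "F 0"] by simp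
    qed
    ultimately show ?thesis
      using powser_sums_zero[of "fps_nth B"] by (auto simp: eventually_nhds_conv_at B_def)
  qed
  hence "F has_fps_expansion B"
    by (rule has_fps_expansionI)
  with A have AB: "A = B" by (rule fps_expansion_unique_complex)
  define a where "a = (\<lambda>n. fact n * Re (fps_nth A n))"
  have "fps_nth A n = complex_of_real (Re (fps_nth A n))" for n
    using arg_cong[OF AB, of "\<lambda>F. fps_nth F n"] by (simp add: B_def complex_eq_iff)
  hence a: "complex_of_real (a n) / fact n = fps_nth A n" for n
    by (simp add: a_def)
  have "has_egf f a"
    unfolding has_egf_def using ball eq
  proof eventually_elim
    case (elim z)
    have "(\<lambda>n. complex_of_real (a n) / fact n * z ^ n) sums F z"
      unfolding a by (rule sums[OF elim(1)])
    thus ?case using elim by (simp add: field_simps)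
  qed
  thus ?thesis using egf_coeffs_eq by simp
qed


section \<open>Generalized Bernoulli and Apostol--Euler polynomials\<close>

text \<open>The principal branch in \<open>powr\<close> is the one with value \<open>1\<close> at base \<open>1\<close>, i.e. for \<open>z \<rightarrow> 0\<close>.\<close>

definition gen_bernoulli :: "real \<Rightarrow> nat \<Rightarrow> real \<Rightarrow> real" where
  "gen_bernoulli t n x =
     egf_coeffs (\<lambda>z. (z / (exp z - 1)) powr complex_of_real t * exp (complex_of_real x * z)) n"

definition gen_apostol_euler :: "real \<Rightarrow> real \<Rightarrow> nat \<Rightarrow> real \<Rightarrow> real" where
  "gen_apostol_euler t \<beta> n x =
     egf_coeffs (\<lambda>z. exp (complex_of_real x * z) /
       (1 + complex_of_real \<beta> * (exp z - 1)) powr complex_of_real t) n"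

definition bernoulli_poly :: "nat \<Rightarrow> real \<Rightarrow> real" where
  "bernoulli_poly = gen_bernoulli 1"

definition apostol_euler_poly :: "real \<Rightarrow> nat \<Rightarrow> real \<Rightarrow> real" where
  "apostol_euler_poly \<beta> = gen_apostol_euler 1 \<beta>"

lemma has_egf_gen_bernoulli:
  "has_egf (\<lambda>z. (z / (exp z - 1)) powr complex_of_real t * exp (complex_of_real x * z))
     (\<lambda>n. gen_bernoulli t n x)"
proof -
  define h :: "complex \<Rightarrow> complex" where "h = (\<lambda>z. if z = 0 then 1 else (exp z - 1) / z)"
  define G :: "complex \<Rightarrow> complex" where "G = (\<lambda>z. inverse (h z))"
  have "(\<lambda>z. if z = 0 then deriv exp (0::complex) else (exp z - exp 0) / (z - 0)) holomorphic_on UNIV"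
    by (rule pole_lemma_open) (auto intro!: holomorphic_intros)
  moreover have "deriv exp (0::complex) = 1"
    using DERIV_imp_deriv[OF DERIV_exp[of "0::complex"]] by simp
  ultimately have "h holomorphic_on UNIV"
    unfolding h_def by (simp only: exp_zero diff_zero)
  hence h: "h analytic_on {0}"
    by (auto simp: analytic_at)
  have "G analytic_on {0}"
    unfolding G_def using h by (intro analytic_intros) (auto simp: h_def)
  have lim: "G \<midarrow>0\<rightarrow> 1"
    using analytic_at_imp_isCont[OF \<open>G analytic_on {0}\<close>] by (simp add: isCont_def G_def h_def)
  have Re: "\<forall>\<^sub>F z in at 0. Re (G z) > 0"
    using order_tendstoD(1)[OF tendsto_Re[OF lim], of 0] by simp
  let ?F = "\<lambda>z. G z powr complex_of_real t * exp (complex_of_real x * z)"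
  show ?thesis
    unfolding gen_bernoulli_def
  proof (rule has_egf_egf_coeffs)
    show "?F analytic_on {0}"
      using \<open>G analytic_on {0}\<close> by (intro analytic_intros) (auto simp: G_def h_def)
    show "\<forall>\<^sub>F z in at 0. ?F (cnj z) = cnj (?F z)"
      using Re
    proof eventually_elim
      case (elim z)
      have "G (cnj z) = cnj (G z)"
        by (simp add: G_def h_def exp_cnj)
      thus ?case using elim by (simp add: cnj_powr exp_cnj)
    qed
    show "\<forall>\<^sub>F z in at 0. ?F z = (z / (exp z - 1)) powr complex_of_real t * exp (complex_of_real x * z)"
      using eventually_neq_at_within[of 0 0 UNIV] by eventually_elim (auto simp: G_def h_def)
  qed
qed

lemma has_egf_gen_apostol_euler:
  "has_egf (\<lambda>z. exp (complex_of_real x * z) /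
       (1 + complex_of_real \<beta> * (exp z - 1)) powr complex_of_real t)
     (\<lambda>n. gen_apostol_euler t \<beta> n x)"
proof -
  define G :: "complex \<Rightarrow> complex" where "G = (\<lambda>z. 1 + complex_of_real \<beta> * (exp z - 1))"
  have G: "G analytic_on {0}"
    unfolding G_def by (intro analytic_intros)
  have lim: "G \<midarrow>0\<rightarrow> 1"
    using analytic_at_imp_isCont[OF G] by (simp add: isCont_def G_def)
  have Re: "\<forall>\<^sub>F z in at 0. Re (G z) > 0"
    using order_tendstoD(1)[OF tendsto_Re[OF lim], of 0] by simp
  let ?F = "\<lambda>z. exp (complex_of_real x * z) / G z powr complex_of_real t"
  have "has_egf ?F (egf_coeffs ?F)"
  proof (rule has_egf_egf_coeffs)
    show "?F analytic_on {0}"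
      using G by (intro analytic_intros) (auto simp: G_def)
    show "\<forall>\<^sub>F z in at 0. ?F (cnj z) = cnj (?F z)"
      using Re
    proof eventually_elim
      case (elim z)
      have "G (cnj z) = cnj (G z)"
        by (simp add: G_def exp_cnj)
      thus ?case using elim by (simp add: cnj_powr exp_cnj)
    qed
  qed auto
  thus ?thesis
    by (simp add: G_def gen_apostol_euler_def)
qed


section \<open>Binomial convolution, forward differences, Stirling numbers\<close>

definition binomial_convolution ::
    "(nat \<Rightarrow> real \<Rightarrow> real) \<Rightarrow> (nat \<Rightarrow> real \<Rightarrow> real) \<Rightarrow> nat \<Rightarrow> real \<Rightarrow> real" where
  "binomial_convolution A C n x = (\<Sum>k=0..n. real (n choose k) * A k 0 * C (n - k) x)"

definition forward_diff :: "nat \<Rightarrow> (real \<Rightarrow> real) \<Rightarrow> real \<Rightarrow> real" where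
  "forward_diff k f x = (\<Sum>j=0..k. real (k choose j) * (- 1) ^ (k - j) * f (x + real j))"

text \<open>Signed Stirling numbers of the first kind.\<close>

definition stirling1 :: "nat \<Rightarrow> nat \<Rightarrow> int" where
  "stirling1 n k = coeff (\<Prod>i<n. [:- int i, 1:]) k"

lemma falling_factorial_stirling1:
  "(\<Prod>i<n. (x :: real) - real i) = (\<Sum>k=0..n. of_int (stirling1 n k) * x ^ k)"
proof -
  define P :: "nat \<Rightarrow> real poly" where "P = (\<lambda>n. \<Prod>i<n. [:- real i, 1:])"
  have P_Suc: "P (Suc n) = smult (- real n) (P n) + pCons 0 (P n)" for n
    by (simp add: P_def mult_pCons_right)
  have stirling1_Suc: "stirling1 (Suc n) k =
      (case k of 0 \<Rightarrow> 0 | Suc k' \<Rightarrow> stirling1 n k') - int n * stirling1 n k" for n k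
    by (simp add: stirling1_def mult_pCons_right coeff_pCons split: nat.splits)
  have coeff_P: "coeff (P n) k = of_int (stirling1 n k)" for k
  proof (induction n arbitrary: k)
    case 0
    show ?case by (cases k) (simp_all add: P_def stirling1_def)
  next
    case (Suc n)
    show ?case
      by (cases k) (simp_all add: P_Suc stirling1_Suc Suc.IH)
  qed
  have "degree (P n) \<le> n"
  proof (induction n)
    case (Suc n)
    have "degree (P (Suc n)) \<le> max (degree (P n)) (Suc (degree (P n)))"
      unfolding P_Suc by (intro degree_add_le_max[THEN order_trans] max.mono degree_smult_le degree_pCons_le)
    thus ?case using Suc by simp
  qed (simp add: P_def)
  hence "poly (P n) x = (\<Sum>k\<le>n. of_int (stirling1 n k) * x ^ k)"
    unfolding coeff_P[symmetric] poly_altdef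
    by (intro sum.mono_neutral_left) (auto simp: coeff_eq_0)
  moreover have "poly (P n) x = (\<Prod>i<n. x - real i)"
    by (simp add: P_def poly_prod)
  ultimately show ?thesis
    by (simp add: atLeast0AtMost)
qed

end

theory Submission
  imports Defs
begin

text \<open>
  Write \<open>u = e\<^sup>z - 1\<close>. The exponential generating functions of the generalized Bernoulli polynomials
  of order \<open>m\<close> and of the generalized Apostol--Euler polynomials of order \<open>r\<close> at \<open>x\<close> are
  \<open>(z / u)\<^sup>m e\<^sup>x\<^sup>z\<close> and \<open>(1 + \<beta> u)\<^bsup>-r\<^esup> e\<^sup>x\<^sup>z\<close>. Both sides of the first equation are therefore \<open>n!\<close> times
  the \<open>n\<close>-th coefficient of the same formal power series \<open>(z / u)\<^sup>m (1 + \<beta> u)\<^bsup>-r\<^esup> e\<^sup>x\<^sup>z\<close>: the multinomial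
  sum splits it into its \<open>m + r\<close> factors of order \<open>1\<close>, distributing the exponent \<open>x\<close> as
  \<open>x\<^sub>1 + \<dots> + x\<^bsub>m+r\<^esub>\<close>, and the binomial convolution splits it into two
  (\<open>fps_egf_gen_bernoulli\<close>, \<open>fps_egf_gen_apostol_euler\<close>).

  For the second equation, the factor in front of \<open>e\<^sup>x\<^sup>z\<close> is expanded in powers of \<open>u\<close>. Since
  \<open>z = ln (1 + u)\<close>, the factor \<open>(z / u)\<^sup>m\<close> becomes \<open>(ln (1 + u) / u)\<^sup>m\<close>, whose coefficients are
  \<open>m! s(m + k, m) / (m + k)!\<close> (\<open>stirling1_shift_compose\<close>); \<open>(1 + \<beta> u)\<^bsup>-r\<^esup>\<close> is a binomial series
  (\<open>binomial_series_compose\<close>). Their Cauchy product is \<open>\<Sum> v\<^sub>k u\<^sup>k\<close>. Finally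
  \<open>u\<^sup>k e\<^sup>x\<^sup>z\<close> is the exponential generating function of \<open>n \<mapsto> \<Delta>\<^sup>k I\<^sub>n(x)\<close>
  (\<open>fps_exp_times_power_nth\<close>), because multiplication by \<open>e\<^sup>z\<close> shifts the argument by \<open>1\<close>.

  Everything takes place among real formal power series. The analytic definitions enter only
  through \<open>fps_egf_mult_eqI\<close>, which turns an identity between functions near \<open>0\<close> into one between
  formal series.
\<close>

section \<open>Coefficients of products and compositions\<close>

lemma finite_PiE_sum_eq:
  assumes "finite I"
  shows   "finite {j \<in> I \<rightarrow>\<^sub>E (UNIV :: nat set). sum j I = n}"
proof (rule finite_subset)
  show "{j \<in> I \<rightarrow>\<^sub>E (UNIV :: nat set). sum j I = n} \<subseteq> I \<rightarrow>\<^sub>E {..n}"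
    using assms by (auto simp: PiE_def intro: member_le_sum)
qed (use assms in \<open>auto intro: finite_PiE\<close>)

text \<open>
  The multinomial form of the Cauchy product. A function on \<open>insert x I\<close> with sum \<open>n\<close> is the same as
  a value \<open>i \<le> n\<close> at \<open>x\<close> together with a function on \<open>I\<close> with sum \<open>n - i\<close>.
\<close>

lemma fps_nth_prod:
  fixes F :: "'a \<Rightarrow> 'b :: comm_ring_1 fps"
  assumes "finite I"
  shows   "(\<Prod>i\<in>I. F i) $ n =
             (\<Sum>j\<in>{j \<in> I \<rightarrow>\<^sub>E UNIV. sum j I = n}. \<Prod>i\<in>I. F i $ j i)"
  using assms
proof (induction I arbitrary: n rule: finite_induct)
  case empty
  have "{j \<in> {} \<rightarrow>\<^sub>E (UNIV :: nat set). sum j {} = n} = (if n = 0 then {\<lambda>_. undefined} else {})"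
    by auto
  thus ?case by simp
next
  case (insert x I)
  define S where "S = (\<lambda>I n. {j \<in> (I :: 'a set) \<rightarrow>\<^sub>E (UNIV :: nat set). sum j I = n})"
  have fin: "finite (S I n)" for n
    unfolding S_def using insert.hyps(1) by (rule finite_PiE_sum_eq)
  have upd: "(\<Sum>i\<in>I. if i = x then a else g i) = sum g I" for a and g :: "'a \<Rightarrow> nat"
    using insert.hyps(2) by (intro sum.cong) auto
  have "(\<Prod>i\<in>insert x I. F i) $ n = (\<Sum>i=0..n. \<Sum>g\<in>S I (n - i). F x $ i * (\<Prod>k\<in>I. F k $ g k))"
    using insert.hyps by (simp add: fps_mult_nth insert.IH S_def sum_distrib_left)
  also have "\<dots> = (\<Sum>(i, g)\<in>(SIGMA i:{0..n}. S I (n - i)). F x $ i * (\<Prod>k\<in>I. F k $ g k))"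
    using fin by (subst sum.Sigma) auto
  also have "\<dots> = (\<Sum>j\<in>S (insert x I) n. \<Prod>i\<in>insert x I. F i $ j i)"
  proof (rule sum.reindex_bij_witness[of _ "\<lambda>j. (j x, restrict j I)" "\<lambda>(i, g). g(x := i)"])
    fix p assume "p \<in> (SIGMA i:{0..n}. S I (n - i))"
    then obtain i g where p: "p = (i, g)" "i \<le> n" "g \<in> I \<rightarrow>\<^sub>E UNIV" "sum g I = n - i"
      by (auto simp: S_def)
    show "(case p of (i, g) \<Rightarrow> g(x := i)) \<in> S (insert x I) n"
      using p insert.hyps by (auto simp: S_def upd PiE_def extensional_def)
    show "((case p of (i, g) \<Rightarrow> g(x := i)) x, restrict (case p of (i, g) \<Rightarrow> g(x := i)) I) = p"
      using p insert.hyps by (auto simp: fun_eq_iff PiE_def extensional_def restrict_def)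
    have "(\<Prod>k\<in>I. F k $ (g(x := i)) k) = (\<Prod>k\<in>I. F k $ g k)"
      using insert.hyps by (intro prod.cong) auto
    thus "(\<Prod>k\<in>insert x I. F k $ (case p of (i, g) \<Rightarrow> g(x := i)) k) =
          (case p of (i, g) \<Rightarrow> F x $ i * (\<Prod>k\<in>I. F k $ g k))"
      using p(1) insert.hyps by simp
  next
    fix j assume j: "j \<in> S (insert x I) n"
    show "(case (j x, restrict j I) of (i, g) \<Rightarrow> g(x := i)) = j"
      using j insert.hyps by (auto simp: S_def fun_eq_iff PiE_def extensional_def)
    show "(j x, restrict j I) \<in> (SIGMA i:{0..n}. S I (n - i))"
      using j insert.hyps by (auto simp: S_def)
  qed
  finally show ?case by (simp add: S_def)
qed

text \<open>
  Multiplication by \<open>F\<close> commutes with the infinite sum \<open>\<Sum> V\<^sub>k W\<^sup>k\<close>. Cutting the sum off at \<open>k = n\<close> is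
  harmless because \<open>W\<^sup>k\<close> starts in degree \<open>k\<close> or later.
\<close>

lemma fps_mult_compose_nth:
  fixes F V W :: "'a :: comm_ring_1 fps"
  assumes "W $ 0 = 0"
  shows   "(F * (V oo W)) $ n = (\<Sum>k=0..n. V $ k * (F * W ^ k) $ n)"
proof -
  have comp: "(V oo W) $ i = (\<Sum>k=0..n. V $ k * (W ^ k) $ i)" if "i \<le> n" for i
    unfolding fps_compose_nth using that startsby_zero_power_prefix[OF assms]
    by (intro sum.mono_neutral_left) auto
  have "(F * (V oo W)) $ n = (\<Sum>i=0..n. \<Sum>k=0..n. F $ i * (V $ k * (W ^ k) $ (n - i)))"
    by (simp add: fps_mult_nth comp sum_distrib_left)
  also have "\<dots> = (\<Sum>k=0..n. \<Sum>i=0..n. F $ i * (V $ k * (W ^ k) $ (n - i)))"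
    by (rule sum.swap)
  also have "\<dots> = (\<Sum>k=0..n. V $ k * (F * W ^ k) $ n)"
    by (simp add: fps_mult_nth sum_distrib_left mult_ac)
  finally show ?thesis .
qed

lemma prod_fps_exp:
  fixes c :: "'a \<Rightarrow> 'b :: field_char_0"
  shows "(\<Prod>i\<in>I. fps_exp (c i)) = fps_exp (\<Sum>i\<in>I. c i)"
  by (induction I rule: infinite_finite_induct) (simp_all add: fps_exp_add_mult)

section \<open>Formal exponential generating functions\<close>

definition fps_egf :: "(nat \<Rightarrow> real) \<Rightarrow> real fps" where
  "fps_egf a = Abs_fps (\<lambda>n. a n / fact n)"

lemma fps_egf_nth [simp]: "fps_egf a $ n = a n / fact n"
  by (simp add: fps_egf_def)

text \<open>
  The polynomials have real values but are defined by complex functions. This embedding lets the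
  algebra be done with real coefficients.
\<close>

definition fps_complex_of_real :: "real fps \<Rightarrow> complex fps" where
  "fps_complex_of_real F = Abs_fps (\<lambda>n. complex_of_real (F $ n))"

lemma fps_complex_of_real_nth [simp]:
  "fps_complex_of_real F $ n = complex_of_real (F $ n)"
  by (simp add: fps_complex_of_real_def)

lemma fps_complex_of_real_eq_iff [simp]:
  "fps_complex_of_real F = fps_complex_of_real G \<longleftrightarrow> F = G"
  by (simp add: fps_eq_iff)

lemma fps_complex_of_real_simps [simp]:
  "fps_complex_of_real 1 = 1"
  "fps_complex_of_real fps_X = fps_X"
  "fps_complex_of_real (fps_const c) = fps_const (complex_of_real c)"
  "fps_complex_of_real (fps_exp c) = fps_exp (complex_of_real c)"
  "fps_complex_of_real (F + G) = fps_complex_of_real F + fps_complex_of_real G"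
  "fps_complex_of_real (F - G) = fps_complex_of_real F - fps_complex_of_real G"
  "fps_complex_of_real (F * G) = fps_complex_of_real F * fps_complex_of_real G"
  by (simp_all add: fps_eq_iff fps_mult_nth)

lemma fps_complex_of_real_power [simp]:
  "fps_complex_of_real (F ^ n) = fps_complex_of_real F ^ n"
  by (induction n) simp_all

text \<open>
  Transfer from functions to formal series. The factor \<open>g\<close> serves to clear a denominator in \<open>f\<close>, so
  that no quotient has to be expanded analytically. As \<open>f\<close> is controlled only on a
  punctured neighbourhood of \<open>0\<close>, the comparison uses the uniqueness of Laurent expansions.
\<close>

lemma fps_egf_mult_eqI:
  assumes "has_egf f a"
    and G: "g has_fps_expansion fps_complex_of_real G"
    and H: "h has_fps_expansion fps_complex_of_real H"
    and eq: "\<forall>\<^sub>F z in at 0. f z * g z = h z"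
  shows "fps_egf a * G = H"
proof -
  have "Abs_fps (\<lambda>n. complex_of_real (a n) / fact n) = fps_complex_of_real (fps_egf a)"
    by (simp add: fps_eq_iff)
  hence "f has_laurent_expansion fps_to_fls (fps_complex_of_real (fps_egf a))"
    using has_egf_imp_laurent[OF assms(1)] by simp
  hence "(\<lambda>z. f z * g z) has_laurent_expansion
           fps_to_fls (fps_complex_of_real (fps_egf a)) * fps_to_fls (fps_complex_of_real G)"
    using has_laurent_expansion_mult has_laurent_expansion_fps[OF G] by blast
  hence "h has_laurent_expansion
           fps_to_fls (fps_complex_of_real (fps_egf a)) * fps_to_fls (fps_complex_of_real G)"
    using has_laurent_expansion_cong[OF eq refl] by blast
  from has_laurent_expansion_unique[OF this has_laurent_expansion_fps[OF H]]
  have "fps_to_fls (fps_complex_of_real (fps_egf a * G)) = fps_to_fls (fps_complex_of_real H)"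
    by (simp add: fls_times_fps_to_fls)
  thus ?thesis by (simp del: fps_complex_of_real_simps)
qed

abbreviation exp_minus_one :: "real fps" where
  "exp_minus_one \<equiv> fps_exp 1 - 1"

lemma exp_minus_one_nonzero: "exp_minus_one \<noteq> 0"
proof
  assume "exp_minus_one = 0"
  hence "exp_minus_one $ 1 = 0" by simp
  thus False by simp
qed

lemma fps_egf_gen_bernoulli_times:
  assumes "m > 0"
  shows "fps_egf (\<lambda>n. gen_bernoulli (real m) n x) * exp_minus_one ^ m = fps_X ^ m * fps_exp x"
proof (rule fps_egf_mult_eqI[OF has_egf_gen_bernoulli])
  show "(\<lambda>z. (exp z - 1) ^ m) has_fps_expansion fps_complex_of_real (exp_minus_one ^ m)"
    by (auto intro!: fps_expansion_intros)
  show "(\<lambda>z. z ^ m * exp (complex_of_real x * z)) has_fps_expansion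
          fps_complex_of_real (fps_X ^ m * fps_exp x)"
    by (auto intro!: fps_expansion_intros)
  have "\<forall>\<^sub>F z in at 0. exp z \<noteq> (1 :: complex)"
  proof -
    have "\<forall>\<^sub>F z in at 0. z \<noteq> 0 \<and> norm (z :: complex) < 1"
      by (auto simp: eventually_at intro: exI[of _ 1])
    thus ?thesis
    proof eventually_elim
      case (elim z)
      \<comment> \<open>The solutions of \<open>exp z = 1\<close> other than \<open>0\<close> have modulus at least \<open>2 \<pi>\<close>.\<close>
      show ?case
      proof
        assume "exp z = 1"
        then obtain n :: int where n: "Re z = 0" "Im z = of_int (2 * n) * pi"
          by (auto simp: exp_eq_1)
        have "n \<noteq> 0" using elim n by (auto simp: complex_eq_iff)
        hence "1 \<le> \<bar>real_of_int n\<bar>" by linarith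
        hence "1 * 2 \<le> \<bar>real_of_int n\<bar> * pi"
          using pi_ge_two by (intro mult_mono) auto
        hence "\<bar>Im z\<bar> > 1" using n by (simp add: abs_mult)
        thus False using elim abs_Im_le_cmod[of z] by simp
      qed
    qed
  qed
  thus "\<forall>\<^sub>F z in at 0. (z / (exp z - 1)) powr complex_of_real (real m) *
          exp (complex_of_real x * z) * (exp z - 1) ^ m = z ^ m * exp (complex_of_real x * z)"
  proof eventually_elim
    case (elim z)
    have "(z / (exp z - 1)) powr complex_of_real (real m) = z ^ m / (exp z - 1) ^ m"
      using assms by (simp add: powr_nat' power_divide)
    thus ?case using elim by simp
  qed
qed

lemma fps_egf_gen_apostol_euler_times:
  assumes "r > 0"
  shows "fps_egf (\<lambda>n. gen_apostol_euler (real r) \<beta> n x) *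
           (1 + fps_const \<beta> * exp_minus_one) ^ r = fps_exp x"
proof (rule fps_egf_mult_eqI[OF has_egf_gen_apostol_euler])
  let ?g = "\<lambda>z. 1 + complex_of_real \<beta> * (exp z - 1)"
  show "(\<lambda>z. ?g z ^ r) has_fps_expansion
          fps_complex_of_real ((1 + fps_const \<beta> * exp_minus_one) ^ r)"
    by (auto intro!: fps_expansion_intros)
  show "(\<lambda>z. exp (complex_of_real x * z)) has_fps_expansion fps_complex_of_real (fps_exp x)"
    by (auto intro!: fps_expansion_intros)
  have "(?g \<longlongrightarrow> ?g 0) (at 0)"
    by (intro tendsto_intros)
  hence "\<forall>\<^sub>F z in at 0. ?g z \<noteq> 0"
    by (rule tendsto_imp_eventually_ne) simp
  thus "\<forall>\<^sub>F z in at 0. exp (complex_of_real x * z) / ?g z powr complex_of_real (real r) *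
          ?g z ^ r = exp (complex_of_real x * z)"
  proof eventually_elim
    case (elim z)
    thus ?case using assms by (simp add: powr_nat')
  qed
qed

definition bernoulli_fps :: "real fps" where
  "bernoulli_fps = fps_X / exp_minus_one"

text \<open>The division is exact since \<open>e\<^sup>z - 1\<close> is \<open>z\<close> times a unit.\<close>

lemma bernoulli_fps_times: "bernoulli_fps * exp_minus_one = fps_X"
proof -
  have "exp_minus_one = fps_X * fps_shift 1 exp_minus_one"
    by (simp add: fps_eq_iff fps_X_mult_nth)
  moreover have "is_unit (fps_shift 1 exp_minus_one)"
    by simp
  ultimately have "exp_minus_one dvd fps_X"
    by (metis dvd_refl mult_unit_dvd_iff)
  thus ?thesis by (simp add: bernoulli_fps_def)
qed

lemma fps_egf_gen_bernoulli:
  assumes "m > 0"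
  shows "fps_egf (\<lambda>n. gen_bernoulli (real m) n x) = bernoulli_fps ^ m * fps_exp x"
proof -
  have "fps_egf (\<lambda>n. gen_bernoulli (real m) n x) * exp_minus_one ^ m =
        (bernoulli_fps ^ m * fps_exp x) * exp_minus_one ^ m"
    unfolding fps_egf_gen_bernoulli_times[OF assms]
    by (simp add: bernoulli_fps_times[symmetric] power_mult_distrib mult_ac)
  thus ?thesis using exp_minus_one_nonzero by simp
qed

definition apostol_euler_fps :: "real \<Rightarrow> real fps" where
  "apostol_euler_fps \<beta> = inverse (1 + fps_const \<beta> * exp_minus_one)"

lemma apostol_euler_fps_times:
  "apostol_euler_fps \<beta> * (1 + fps_const \<beta> * exp_minus_one) = 1"
  unfolding apostol_euler_fps_def by (rule inverse_mult_eq_1) simp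

lemma fps_egf_gen_apostol_euler:
  assumes "r > 0"
  shows "fps_egf (\<lambda>n. gen_apostol_euler (real r) \<beta> n x) = apostol_euler_fps \<beta> ^ r * fps_exp x"
proof -
  let ?D = "1 + fps_const \<beta> * exp_minus_one"
  have "fps_egf (\<lambda>n. gen_apostol_euler (real r) \<beta> n x) =
        fps_egf (\<lambda>n. gen_apostol_euler (real r) \<beta> n x) * (apostol_euler_fps \<beta> * ?D) ^ r"
    by (simp add: apostol_euler_fps_times)
  also have "\<dots> = apostol_euler_fps \<beta> ^ r *
      (fps_egf (\<lambda>n. gen_apostol_euler (real r) \<beta> n x) * ?D ^ r)"
    by (simp only: power_mult_distrib mult_ac)
  finally show ?thesis
    by (simp only: fps_egf_gen_apostol_euler_times[OF assms])
qed

lemma fps_egf_binomial_convolution: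
  "fps_egf (\<lambda>n. binomial_convolution A C n x) = fps_egf (\<lambda>n. A n 0) * fps_egf (\<lambda>n. C n x)"
proof (rule fps_ext)
  fix n
  have "real (n choose k) * A k 0 * C (n - k) x / fact n =
        A k 0 / fact k * (C (n - k) x / fact (n - k))" if "k \<le> n" for k
    using that by (simp add: binomial_fact)
  thus "fps_egf (\<lambda>n. binomial_convolution A C n x) $ n =
        (fps_egf (\<lambda>n. A n 0) * fps_egf (\<lambda>n. C n x)) $ n"
    by (simp add: binomial_convolution_def fps_mult_nth sum_divide_distrib)
qed

section \<open>Expansion in powers of \<open>e\<^sup>z - 1\<close>\<close>

text \<open>
  By the binomial theorem, \<open>(e\<^sup>z - 1)\<^sup>k e\<^sup>x\<^sup>z\<close> is the alternating sum of the \<open>e\<^bsup>(x + j) z\<^esup>\<close>, and the \<open>n\<close>-th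
  derivative of \<open>e\<^bsup>(x + j) z\<^esup>\<close> at \<open>0\<close> is \<open>(x + j)\<^sup>n\<close>.
\<close>

lemma fps_exp_times_power_nth:
  "(fps_exp x * exp_minus_one ^ k) $ n = forward_diff k (\<lambda>y. y ^ n) x / fact n"
proof -
  have "fps_exp x * exp_minus_one ^ k = fps_exp x * (fps_exp 1 + (- 1)) ^ k"
    by simp
  also have "\<dots> = (\<Sum>j\<le>k. of_nat (k choose j) * (- 1) ^ (k - j) * (fps_exp x * fps_exp 1 ^ j))"
    unfolding binomial_ring by (simp add: sum_distrib_left mult_ac)
  also have "\<dots> = (\<Sum>j\<le>k. fps_const (real (k choose j) * (- 1) ^ (k - j)) * fps_exp (x + real j))"
    by (simp add: fps_exp_power_mult fps_exp_add_mult fps_of_nat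
             flip: fps_const_mult fps_const_power fps_const_neg)
  finally show ?thesis
    by (simp add: forward_diff_def fps_sum_nth sum_divide_distrib atLeast0AtMost)
qed

lemma stirling1_Suc:
  "stirling1 (Suc n) k = (case k of 0 \<Rightarrow> 0 | Suc k' \<Rightarrow> stirling1 n k') - int n * stirling1 n k"
  by (simp add: stirling1_def mult_pCons_right coeff_pCons split: nat.splits)

lemma stirling1_0: "stirling1 0 k = (if k = 0 then 1 else 0)"
  by (cases k) (simp_all add: stirling1_def)

lemma stirling1_Suc_0: "stirling1 (Suc n) 0 = 0"
  by (induction n) (simp_all add: stirling1_Suc stirling1_0)

lemma stirling1_eq_0: "n < k \<Longrightarrow> stirling1 n k = 0"
  by (induction n arbitrary: k) (auto simp: stirling1_Suc stirling1_0 split: nat.splits)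

text \<open>This series is \<open>ln (1 + z)\<^sup>m\<close>, as \<open>stirling1_fps_compose\<close> shows.\<close>

definition stirling1_fps :: "nat \<Rightarrow> real fps" where
  "stirling1_fps m = Abs_fps (\<lambda>n. fact m * of_int (stirling1 n m) / fact n)"

lemma stirling1_fps_0: "stirling1_fps 0 = 1"
proof (rule fps_ext)
  show "stirling1_fps 0 $ n = 1 $ n" for n
    by (cases n) (simp_all add: stirling1_fps_def stirling1_0 stirling1_Suc_0)
qed

text \<open>
  The recurrence of the Stirling numbers in the form of the differential equation
  \<open>(1 + z) L' = 1\<close> of the logarithm \<open>L\<close>, applied to the powers of \<open>L\<close>.
\<close>

lemma stirling1_fps_deriv:
  "(1 + fps_X) * fps_deriv (stirling1_fps (Suc m)) = fps_const (real (Suc m)) * stirling1_fps m"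
proof (rule fps_ext)
  fix n
  have deriv_nth: "fps_deriv (stirling1_fps (Suc m)) $ n =
          fact (Suc m) * of_int (stirling1 (Suc n) (Suc m)) / fact n" for n
    by (simp add: stirling1_fps_def field_simps del: of_nat_Suc)
  have "((1 + fps_X) * fps_deriv (stirling1_fps (Suc m))) $ n =
          fact (Suc m) * (of_int (stirling1 (Suc n) (Suc m)) +
            real n * of_int (stirling1 n (Suc m))) / fact n"
  proof (cases n)
    case 0
    show ?thesis
      by (simp add: 0 distrib_right deriv_nth stirling1_0 del: fps_deriv_nth fact_Suc)
  next
    case (Suc k)
    have "fact (Suc m) * real_of_int (stirling1 (Suc k) (Suc m)) / fact k =
            fact (Suc m) * (real (Suc k) * of_int (stirling1 (Suc k) (Suc m))) / fact (Suc k)"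
      by (simp add: fact_Suc[of k] del: of_nat_Suc fact_Suc)
    thus ?thesis
      by (simp add: Suc distrib_right deriv_nth distrib_left add_divide_distrib
               del: fps_deriv_nth fact_Suc of_nat_Suc)
  qed
  also have "\<dots> = fact (Suc m) * of_int (stirling1 n m) / fact n"
    by (simp add: stirling1_Suc del: fact_Suc)
  finally show "((1 + fps_X) * fps_deriv (stirling1_fps (Suc m))) $ n =
                (fps_const (real (Suc m)) * stirling1_fps m) $ n"
    by (simp add: stirling1_fps_def)
qed

text \<open>
  Induction on \<open>m\<close> by differentiation: since \<open>u = e\<^sup>z - 1\<close> satisfies \<open>u' = 1 + u\<close>, the factor
  \<open>1 + z\<close> in \<open>stirling1_fps_deriv\<close> is exactly the inner derivative in the chain rule.
\<close>

lemma stirling1_fps_compose: "stirling1_fps m oo exp_minus_one = fps_X ^ m"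
proof (induction m)
  case (Suc m)
  let ?T = "stirling1_fps (Suc m)"
  have E: "exp_minus_one $ 0 = 0" by simp
  have "fps_deriv (?T oo exp_minus_one) = (fps_deriv ?T oo exp_minus_one) * fps_deriv exp_minus_one"
    by (rule fps_compose_deriv[OF E])
  also have "\<dots> = ((1 + fps_X) * fps_deriv ?T) oo exp_minus_one"
    by (simp add: fps_compose_mult_distrib[OF E] fps_compose_add_distrib mult.commute)
  also have "\<dots> = fps_const (real (Suc m)) * fps_X ^ m"
    unfolding stirling1_fps_deriv fps_compose_mult_distrib[OF E] fps_const_compose Suc.IH ..
  also have "\<dots> = fps_deriv (fps_X ^ Suc m)"
    by (subst fps_deriv_power) simp
  finally have "fps_deriv (?T oo exp_minus_one) = fps_deriv (fps_X ^ Suc m)" .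
  thus ?case
    unfolding fps_deriv_eq_iff by (simp add: stirling1_fps_def stirling1_0)
qed (simp add: stirling1_fps_0)

text \<open>
  The expansion of \<open>(z / (e\<^sup>z - 1))\<^sup>m\<close> in powers of \<open>e\<^sup>z - 1\<close>: divide \<open>stirling1_fps_compose\<close> by
  \<open>(e\<^sup>z - 1)\<^sup>m\<close>, which is possible because \<open>s(n, m) = 0\<close> for \<open>n < m\<close>.
\<close>

lemma stirling1_shift_compose:
  "fps_shift m (stirling1_fps m) oo exp_minus_one = bernoulli_fps ^ m"
proof -
  have E: "exp_minus_one $ 0 = 0" by simp
  have "stirling1_fps m = fps_X ^ m * fps_shift m (stirling1_fps m)"
    by (simp add: fps_eq_iff fps_X_power_mult_nth stirling1_fps_def stirling1_eq_0)
  hence "fps_X ^ m = exp_minus_one ^ m * (fps_shift m (stirling1_fps m) oo exp_minus_one)"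
    using stirling1_fps_compose[of m] fps_compose_mult_distrib[OF E] fps_X_power_compose[OF E]
    by metis
  moreover have "fps_X ^ m = exp_minus_one ^ m * bernoulli_fps ^ m"
    by (simp add: bernoulli_fps_times[symmetric] power_mult_distrib mult_ac)
  ultimately show ?thesis using exp_minus_one_nonzero by simp
qed

text \<open>
  Both sides are inverse to \<open>(1 + \<beta> u)\<^sup>r\<close> for \<open>u = e\<^sup>z - 1\<close>; for the left-hand side this is the addition
  theorem of the binomial series.
\<close>

lemma binomial_series_compose:
  "Abs_fps (\<lambda>j. ((- real r) gchoose j) * \<beta> ^ j) oo exp_minus_one = apostol_euler_fps \<beta> ^ r"
proof -
  let ?X = "fps_const \<beta> * fps_X"
  define P where "P = Abs_fps (\<lambda>j. ((- real r) gchoose j) * \<beta> ^ j)"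
  have E: "exp_minus_one $ 0 = 0" and X: "?X $ 0 = 0" by simp_all
  have P: "P = fps_binomial (- real r) oo ?X"
    by (simp add: P_def fps_compose_linear fps_eq_iff)
  have "fps_binomial (- real r) * (1 + fps_X) ^ r = 1"
    by (simp add: fps_binomial_of_nat[symmetric] fps_binomial_add_mult[symmetric])
  hence "(fps_binomial (- real r) * (1 + fps_X) ^ r) oo ?X = 1"
    by simp
  hence "P * (1 + ?X) ^ r = 1"
    by (simp add: P fps_compose_mult_distrib[OF X] fps_compose_power[OF X, symmetric]
                  fps_compose_add_distrib)
  hence "(P * (1 + ?X) ^ r) oo exp_minus_one = 1"
    by simp
  hence *: "(P oo exp_minus_one) * (1 + fps_const \<beta> * exp_minus_one) ^ r = 1"
    by (simp add: fps_compose_mult_distrib[OF E] fps_compose_power[OF E, symmetric]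
                  fps_compose_add_distrib)
  have "P oo exp_minus_one = (P oo exp_minus_one) *
          (apostol_euler_fps \<beta> * (1 + fps_const \<beta> * exp_minus_one)) ^ r"
    by (simp add: apostol_euler_fps_times)
  also have "\<dots> = apostol_euler_fps \<beta> ^ r *
                    ((P oo exp_minus_one) * (1 + fps_const \<beta> * exp_minus_one) ^ r)"
    by (simp only: power_mult_distrib mult_ac)
  finally have "P oo exp_minus_one = apostol_euler_fps \<beta> ^ r"
    unfolding * by simp
  thus ?thesis by (simp add: P_def)
qed

section \<open>The two expansions of the convolution\<close>

theorem theorem9:
  fixes \<beta> x :: real and m r n :: nat and xs :: "nat \<Rightarrow> real"
  assumes "0 \<le> \<beta>" and "\<beta> \<le> 1"
    and "m \<ge> 1" and "r \<ge> 1"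
    and "(\<Sum>i=1..m+r. xs i) = x"
  shows "(\<Sum>j\<in>{j \<in> {1..m+r} \<rightarrow>\<^sub>E (UNIV :: nat set). (\<Sum>i=1..m+r. j i) = n}.
            fact n / (\<Prod>i=1..m+r. fact (j i)) *
            (\<Prod>i=1..m. bernoulli_poly (j i) (xs i)) *
            (\<Prod>i=m+1..m+r. apostol_euler_poly \<beta> (j i) (xs i)))
         = binomial_convolution (gen_bernoulli (real m)) (gen_apostol_euler (real r) \<beta>) n x
       \<and> binomial_convolution (gen_bernoulli (real m)) (gen_apostol_euler (real r) \<beta>) n x
         = (\<Sum>k=0..n.
              (fact m * (\<Sum>j=0..k. ((- real r) gchoose j) * \<beta> ^ j *
                 (real_of_int (stirling1 (m + k - j) m) / fact (m + k - j)))) *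
              forward_diff k (\<lambda>y. y ^ n) x)"
proof -
  define conv where
    "conv = (\<lambda>n. binomial_convolution (gen_bernoulli (real m)) (gen_apostol_euler (real r) \<beta>) n x)"
  \<comment> \<open>\<open>H\<close> is the factor of the generating function that does not depend on \<open>x\<close>.\<close>
  define H where "H = bernoulli_fps ^ m * apostol_euler_fps \<beta> ^ r"
  have conv: "fps_egf conv = fps_exp x * H"
    using assms
    by (simp add: conv_def H_def fps_egf_binomial_convolution fps_egf_gen_bernoulli
                  fps_egf_gen_apostol_euler mult_ac)
  hence conv_nth: "conv n = fact n * (fps_exp x * H) $ n"
    using fps_egf_nth[of conv n] by simp

  have split: "{1..m+r} = {1..m} \<union> {m+1..m+r}" "{1..m} \<inter> {m+1..m+r} = {}"
    by auto
  define f where "f = (\<lambda>i k. if i \<le> m then bernoulli_poly k (xs i) else apostol_euler_poly \<beta> k (xs i))"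
  have f_egf: "fps_egf (f i) =
      (if i \<le> m then bernoulli_fps else apostol_euler_fps \<beta>) * fps_exp (xs i)" for i
    using fps_egf_gen_bernoulli[of 1] fps_egf_gen_apostol_euler[of 1]
    by (simp add: f_def bernoulli_poly_def apostol_euler_poly_def)
  have "(\<Prod>i=1..m+r. fps_egf (f i)) =
          (\<Prod>i=1..m+r. if i \<le> m then bernoulli_fps else apostol_euler_fps \<beta>) * fps_exp x"
    unfolding f_egf prod.distrib prod_fps_exp assms(5) ..
  also have "(\<Prod>i=1..m+r. if i \<le> m then bernoulli_fps else apostol_euler_fps \<beta>) = H"
    unfolding H_def split(1) using split(2) by (subst prod.union_disjoint) auto
  finally have "conv n = fact n * (\<Prod>i=1..m+r. fps_egf (f i)) $ n"
    by (simp only: conv_nth mult.commute)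
  also have "\<dots> = (\<Sum>j\<in>{j \<in> {1..m+r} \<rightarrow>\<^sub>E UNIV. (\<Sum>i=1..m+r. j i) = n}.
            fact n * (\<Prod>i=1..m+r. f i (j i) / fact (j i)))"
    by (simp add: fps_nth_prod sum_distrib_left)
  also have "\<dots> = (\<Sum>j\<in>{j \<in> {1..m+r} \<rightarrow>\<^sub>E UNIV. (\<Sum>i=1..m+r. j i) = n}.
            fact n / (\<Prod>i=1..m+r. fact (j i)) *
            (\<Prod>i=1..m. bernoulli_poly (j i) (xs i)) *
            (\<Prod>i=m+1..m+r. apostol_euler_poly \<beta> (j i) (xs i)))"
  proof (rule sum.cong[OF refl])
    fix j :: "nat \<Rightarrow> nat"
    have "(\<Prod>i=1..m+r. f i (j i)) = (\<Prod>i=1..m. f i (j i)) * (\<Prod>i=m+1..m+r. f i (j i))"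
      unfolding split(1) using split(2) by (intro prod.union_disjoint) auto
    also have "\<dots> = (\<Prod>i=1..m. bernoulli_poly (j i) (xs i)) *
                    (\<Prod>i=m+1..m+r. apostol_euler_poly \<beta> (j i) (xs i))"
      by (intro arg_cong2[of _ _ _ _ "(*)"] prod.cong) (auto simp: f_def)
    finally show "fact n * (\<Prod>i=1..m+r. f i (j i) / fact (j i)) =
            fact n / (\<Prod>i=1..m+r. fact (j i)) *
            (\<Prod>i=1..m. bernoulli_poly (j i) (xs i)) *
            (\<Prod>i=m+1..m+r. apostol_euler_poly \<beta> (j i) (xs i))"
      by (simp add: prod_dividef)
  qed
  finally have multinomial: "conv n = \<dots>" .

  \<comment> \<open>\<open>V(u)\<close> is \<open>H\<close> as a series in \<open>u\<close>; its coefficients are the \<open>v\<^sub>k\<close>.\<close>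
  define V where "V = Abs_fps (\<lambda>j. ((- real r) gchoose j) * \<beta> ^ j) * fps_shift m (stirling1_fps m)"
  have V_nth: "V $ k = fact m * (\<Sum>j=0..k. ((- real r) gchoose j) * \<beta> ^ j *
                 (real_of_int (stirling1 (m + k - j) m) / fact (m + k - j)))" for k
    unfolding V_def fps_mult_nth sum_distrib_left
    by (intro sum.cong) (auto simp: stirling1_fps_def add.commute)
  have E: "exp_minus_one $ 0 = 0" by simp
  have "H = V oo exp_minus_one"
    unfolding V_def fps_compose_mult_distrib[OF E] binomial_series_compose stirling1_shift_compose H_def
    by (rule mult.commute)
  hence "conv n = fact n * (\<Sum>k=0..n. V $ k * (fps_exp x * exp_minus_one ^ k) $ n)"
    by (simp only: conv_nth fps_mult_compose_nth[OF E])
  also have "\<dots> = (\<Sum>k=0..n. V $ k * forward_diff k (\<lambda>y. y ^ n) x)"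
    by (simp add: fps_exp_times_power_nth sum_distrib_left)
  finally show ?thesis
    using multinomial unfolding V_nth conv_def by simp
qed

end
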